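(* Let $A$ be an ordered alphabet and $A^{\ast}$ the free monoid on $A$ ordered by the Higman ordering. Let $Ant(A^{\ast})$ be the set of antichains of $A^{\ast}$ and $Ant_{<\omega}(A^{\ast})$ the set of finite antichains, both equipped with concatenation of languages $XY:=\{\alpha\beta:\alpha\in X,\beta\in Y\}$. Then the monoids $Ant^{\circ}(A^{\ast}):=Ant(A^{\ast})\setminus\{\emptyset\}$ and $Ant^{\circ}_{<\omega}(A^{\ast}):=Ant_{<\omega}(A^{\ast})\setminus\{\emptyset\}$ are free.
   Context: Higman ordering on $A^{\ast}$: for $\alpha=a_0\cdots a_{n-1}$ and $\beta=b_0\cdots b_{m-1}$, $\alpha\le\beta$ iff there is a strictly increasing map $h:\{0,\dots,n-1\}\to\{0,\dots,m-1\}$ with $a_i\le b_{h(i)}$ for all $i$. An antichain is a subset of $A^{\ast}$ any two distinct elements of which are incomparable in the Higman ordering. These sets are closed under concatenation and contain the neutral element $\{\Box\}$ ($\Box$ the empty word). *)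

theory Defs
  imports "HOL-Algebra.Group"
begin

definition higman_le :: "'a rel \<Rightarrow> 'a list \<Rightarrow> 'a list \<Rightarrow> bool" where
  "higman_le r \<alpha> \<beta> \<longleftrightarrow>
     (\<exists>h. strict_mono_on {..<length \<alpha>} h \<and>
          (\<forall>i<length \<alpha>. h i < length \<beta> \<and> (\<alpha> ! i, \<beta> ! h i) \<in> r))"

definition antichains :: "'a set \<Rightarrow> 'a rel \<Rightarrow> 'a list set set" where
  "antichains A r =
     {X. X \<subseteq> lists A \<and>
         (\<forall>\<alpha>\<in>X. \<forall>\<beta>\<in>X. \<alpha> \<noteq> \<beta> \<longrightarrow> \<not> higman_le r \<alpha> \<beta> \<and> \<not> higman_le r \<beta> \<alpha>)}"

definition lang_concat :: "'a list set \<Rightarrow> 'a list set \<Rightarrow> 'a list set" where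
  "lang_concat X Y = {\<alpha> @ \<beta> | \<alpha> \<beta>. \<alpha> \<in> X \<and> \<beta> \<in> Y}"

definition antichain_monoid :: "'a set \<Rightarrow> 'a rel \<Rightarrow> 'a list set monoid" where
  "antichain_monoid A r =
     \<lparr>carrier = antichains A r - {{}}, mult = lang_concat, one = {[]}\<rparr>"

definition fin_antichain_monoid :: "'a set \<Rightarrow> 'a rel \<Rightarrow> 'a list set monoid" where
  "fin_antichain_monoid A r =
     \<lparr>carrier = {X \<in> antichains A r. finite X} - {{}}, mult = lang_concat, one = {[]}\<rparr>"

definition word_monoid :: "'b set \<Rightarrow> 'b list monoid" where
  "word_monoid B = \<lparr>carrier = lists B, mult = (@), one = []\<rparr>"

text \<open>
  A monoid is free if it is isomorphic to the word monoid over some set \<open>B\<close> of generators.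
  Taking \<open>B\<close> inside the element type of \<open>M\<close> is no restriction; see \<open>free_monoidI\<close>.
\<close>

definition free_monoid :: "('b, 'c) monoid_scheme \<Rightarrow> bool" where
  "free_monoid M \<longleftrightarrow> Group.monoid M \<and> (\<exists>B :: 'b set. word_monoid B \<cong> M)"

lemma free_monoidI:
  fixes M :: "('b, 'c) monoid_scheme" and C :: "'d set"
  assumes "Group.monoid M" and "word_monoid C \<cong> M"
  shows "free_monoid M"
proof -
  obtain h where h: "h \<in> iso (word_monoid C) M"
    using assms(2) by (auto simp: is_iso_def)
  have bij: "bij_betw h (lists C) (carrier M)"
    using h by (simp add: iso_def word_monoid_def)
  define g where "g c = h [c]" for c
  have "inj_on g C"
    using inj_onD[OF bij_betw_imp_inj_on[OF bij]] by (fastforce simp: g_def intro: inj_onI)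
  then have "bij_betw g C (g ` C)"
    by (rule inj_on_imp_bij_betw)
  then have gi: "bij_betw (inv_into C g) (g ` C) C"
    by (rule bij_betw_inv_into)
  define k where "k = map (inv_into C g)"
  have "k \<in> iso (word_monoid (g ` C)) (word_monoid C)"
    using gi bij_lists[OF gi]
    by (auto simp: iso_def hom_def word_monoid_def k_def bij_betw_def)
  then have "h \<circ> k \<in> iso (word_monoid (g ` C)) M"
    using h by (rule iso_set_trans)
  then show ?thesis
    using assms(1) unfolding free_monoid_def is_iso_def by blast
qed

end

theory Submission
  imports Defs
begin

text \<open>
  Both monoids are equidivisible and carry a length function that vanishes only at the
  neutral element, hence are free (Levi's lemma). The length of an antichain is the minimal
  length of its words. For equidivisibility let \<open>X Y = Z T\<close>. Every word of this
  antichain is cut once by \<open>X Y\<close> and once by \<open>Z T\<close>. If the first cut came strictly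
  before the second in one word and strictly after it in another, then recombining the pieces would
  give two distinct comparable words. So, up to symmetry, every word is \<open>x u t\<close> with
  \<open>x \<in> X\<close>, \<open>x u \<in> Z\<close>, \<open>u t \<in> Y\<close>, \<open>t \<in> T\<close>, and the middle
  pieces \<open>u\<close> form an antichain \<open>U\<close> with \<open>Z = X U\<close> and \<open>Y = U T\<close>.
\<close>

section \<open>Levi's lemma\<close>

text \<open>Levi's property: two factorisations of one element have a common refinement by a middle
  factor \<open>u\<close>.\<close>

definition equidivisible :: "('b, 'c) monoid_scheme \<Rightarrow> bool" where
  "equidivisible M \<longleftrightarrow>
     (\<forall>x\<in>carrier M. \<forall>y\<in>carrier M. \<forall>z\<in>carrier M. \<forall>t\<in>carrier M. x \<otimes>\<^bsub>M\<^esub> y = z \<otimes>\<^bsub>M\<^esub> t \<longrightarrow>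
        (\<exists>u\<in>carrier M. z = x \<otimes>\<^bsub>M\<^esub> u \<and> y = u \<otimes>\<^bsub>M\<^esub> t \<or> x = z \<otimes>\<^bsub>M\<^esub> u \<and> t = u \<otimes>\<^bsub>M\<^esub> y))"

text \<open>The irreducible elements; they turn out to be the free generators.\<close>

definition monoid_atoms :: "('b, 'c) monoid_scheme \<Rightarrow> 'b set" where
  "monoid_atoms M =
     {x \<in> carrier M. x \<noteq> \<one>\<^bsub>M\<^esub> \<and>
        (\<forall>y\<in>carrier M. \<forall>z\<in>carrier M. x = y \<otimes>\<^bsub>M\<^esub> z \<longrightarrow> y = \<one>\<^bsub>M\<^esub> \<or> z = \<one>\<^bsub>M\<^esub>)}"

section \<open>Unique factorisation into atoms\<close>

context Group.monoid
begin

abbreviation list_prod :: "'a list \<Rightarrow> 'a" where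
  "list_prod bs \<equiv> foldr (\<otimes>) bs \<one>"

lemma list_prod_closed: "bs \<in> lists (carrier G) \<Longrightarrow> list_prod bs \<in> carrier G"
  by (induction bs) auto

lemma list_prod_append:
  "bs \<in> lists (carrier G) \<Longrightarrow> cs \<in> lists (carrier G) \<Longrightarrow>
   list_prod (bs @ cs) = list_prod bs \<otimes> list_prod cs"
  by (induction bs) (auto simp: list_prod_closed m_assoc simp del: foldr_append)

lemma atoms_subset: "monoid_atoms G \<subseteq> carrier G"
  by (auto simp: monoid_atoms_def)

text \<open>Strong induction on \<open>len\<close>: an element that is neither \<open>\<one>\<close>
  nor an atom splits into two factors of nonzero length, so both are shorter.\<close>

lemma list_prod_atoms_surj:
  fixes len :: "'a \<Rightarrow> nat"
  assumes len_mult: "\<And>x y. x \<in> carrier G \<Longrightarrow> y \<in> carrier G \<Longrightarrow> len (x \<otimes> y) = len x + len y"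
    and len_0: "\<And>x. x \<in> carrier G \<Longrightarrow> len x = 0 \<Longrightarrow> x = \<one>"
    and "x \<in> carrier G"
  shows "\<exists>bs\<in>lists (monoid_atoms G). x = list_prod bs"
  using \<open>x \<in> carrier G\<close>
proof (induction "len x" arbitrary: x rule: less_induct)
  case less
  show ?case
  proof (cases "x = \<one> \<or> x \<in> monoid_atoms G")
    case True
    then show ?thesis
    proof
      assume "x = \<one>"
      then show ?thesis by (intro bexI[of _ "[]"]) auto
    next
      assume "x \<in> monoid_atoms G"
      then show ?thesis using less.prems by (intro bexI[of _ "[x]"]) auto
    qed
  next
    case False
    then obtain y z where yz: "y \<in> carrier G" "z \<in> carrier G" "x = y \<otimes> z" "y \<noteq> \<one>" "z \<noteq> \<one>"
      using less.prems by (auto simp: monoid_atoms_def)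
    then have "len y \<noteq> 0" "len z \<noteq> 0" "len x = len y + len z"
      using len_0 len_mult by blast+
    then have "len y < len x" "len z < len x"
      by linarith+
    with less.hyps yz obtain bs cs where bcs: "bs \<in> lists (monoid_atoms G)" "cs \<in> lists (monoid_atoms G)"
      "y = list_prod bs" "z = list_prod cs"
      by meson
    moreover have "x = list_prod (bs @ cs)"
      using list_prod_append[of bs cs] bcs yz(3) subsetD[OF lists_mono[OF atoms_subset]] by simp
    ultimately show ?thesis
      by (intro bexI[of _ "bs @ cs"]) auto
  qed
qed

text \<open>Additivity forces \<open>len \<one> = 0\<close>, so a product equal to
  \<open>\<one>\<close> would give its atom length 0 and make it trivial.\<close>

lemma list_prod_atoms_ne_one:
  fixes len :: "'a \<Rightarrow> nat"
  assumes len_mult: "\<And>x y. x \<in> carrier G \<Longrightarrow> y \<in> carrier G \<Longrightarrow> len (x \<otimes> y) = len x + len y"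
    and len_0: "\<And>x. x \<in> carrier G \<Longrightarrow> len x = 0 \<Longrightarrow> x = \<one>"
    and b: "b \<in> monoid_atoms G" and x: "x \<in> carrier G"
  shows "b \<otimes> x \<noteq> \<one>"
proof
  assume "b \<otimes> x = \<one>"
  moreover have "len \<one> = 0"
    using len_mult[of \<one> \<one>] by simp
  moreover have "b \<in> carrier G" "b \<noteq> \<one>"
    using b by (auto simp: monoid_atoms_def)
  ultimately show False
    using len_mult[of b x] len_0[of b] x by simp
qed

text \<open>Equidivisibility makes one atom a multiple of the other, with cofactor \<open>u\<close>.
  Irreducibility then leaves only \<open>u = \<one>\<close>. This is what allows factorisations to
  be compared letter by letter.\<close>

lemma atom_mult_cancel:
  assumes "equidivisible G" and b: "b \<in> monoid_atoms G" and c: "c \<in> monoid_atoms G"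
    and x: "x \<in> carrier G" and y: "y \<in> carrier G" and eq: "b \<otimes> x = c \<otimes> y"
  shows "b = c \<and> x = y"
proof -
  have bc: "b \<in> carrier G" "c \<in> carrier G" "b \<noteq> \<one>" "c \<noteq> \<one>"
    using b c by (auto simp: monoid_atoms_def)
  obtain u where u: "u \<in> carrier G" "c = b \<otimes> u \<and> x = u \<otimes> y \<or> b = c \<otimes> u \<and> y = u \<otimes> x"
    using assms(1)[unfolded equidivisible_def, rule_format, OF bc(1) x bc(2) y eq] by blast
  then have "u = \<one>"
    using b c bc unfolding monoid_atoms_def by blast
  with u show ?thesis
    using bc x y by auto
qed

text \<open>Equal first atoms are stripped from both words; neither word can run out first, since a
  product starting with an atom is never \<open>\<one>\<close>.\<close>

lemma inj_on_list_prod_atoms: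
  fixes len :: "'a \<Rightarrow> nat"
  assumes len_mult: "\<And>x y. x \<in> carrier G \<Longrightarrow> y \<in> carrier G \<Longrightarrow> len (x \<otimes> y) = len x + len y"
    and len_0: "\<And>x. x \<in> carrier G \<Longrightarrow> len x = 0 \<Longrightarrow> x = \<one>"
    and "equidivisible G"
  shows "inj_on list_prod (lists (monoid_atoms G))"
proof (rule inj_onI)
  fix bs cs
  assume "bs \<in> lists (monoid_atoms G)" "cs \<in> lists (monoid_atoms G)" "list_prod bs = list_prod cs"
  then show "bs = cs"
  proof (induction bs arbitrary: cs rule: list.induct)
    case Nil
    show ?case
    proof (cases cs)
      case (Cons c cs')
      then have "c \<in> monoid_atoms G" "cs' \<in> lists (carrier G)"
        using Nil.prems atoms_subset by auto
      then have "c \<otimes> list_prod cs' \<noteq> \<one>"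
        using list_prod_atoms_ne_one[of len] len_mult len_0 list_prod_closed by blast
      with Nil.prems(3) Cons show ?thesis by simp
    qed simp
  next
    case (Cons b bs)
    have b: "b \<in> monoid_atoms G" "list_prod bs \<in> carrier G"
      using Cons.prems(1) atoms_subset by (auto intro!: list_prod_closed)
    show ?case
    proof (cases cs)
      case Nil
      then show ?thesis
        using list_prod_atoms_ne_one[of len] len_mult len_0 b Cons.prems(3) by auto
    next
      case (Cons c cs')
      then have "c \<in> monoid_atoms G" "list_prod cs' \<in> carrier G"
        using Cons.prems(2) atoms_subset by (auto intro!: list_prod_closed)
      then have "b = c \<and> list_prod bs = list_prod cs'"
        using atom_mult_cancel[OF \<open>equidivisible G\<close> b(1) _ b(2)] Cons Cons.prems(3) by simp
      with Cons.IH[of cs'] Cons Cons.prems show ?thesis by simp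
    qed
  qed
qed

theorem free_monoid_if_equidivisible:
  fixes len :: "'a \<Rightarrow> nat"
  assumes len_mult: "\<And>x y. x \<in> carrier G \<Longrightarrow> y \<in> carrier G \<Longrightarrow> len (x \<otimes> y) = len x + len y"
    and len_0: "\<And>x. x \<in> carrier G \<Longrightarrow> len x = 0 \<Longrightarrow> x = \<one>"
    and "equidivisible G"
  shows "free_monoid G"
proof -
  have sub: "lists (monoid_atoms G) \<subseteq> lists (carrier G)"
    using atoms_subset by (rule lists_mono)
  have "list_prod ` lists (monoid_atoms G) = carrier G"
    using list_prod_atoms_surj[of len, OF len_mult len_0] list_prod_closed sub by blast
  moreover have "inj_on list_prod (lists (monoid_atoms G))"
    using len_mult len_0 assms(3) by (rule inj_on_list_prod_atoms)
  ultimately have "bij_betw list_prod (lists (monoid_atoms G)) (carrier G)"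
    by (intro bij_betw_imageI)
  moreover have "list_prod bs \<in> carrier G" if "bs \<in> lists (monoid_atoms G)" for bs
    using that sub by (intro list_prod_closed) (rule subsetD)
  moreover have "list_prod (bs @ cs) = list_prod bs \<otimes> list_prod cs"
    if "bs \<in> lists (monoid_atoms G)" "cs \<in> lists (monoid_atoms G)" for bs cs
    using that sub by (intro list_prod_append) (rule subsetD; assumption)+
  ultimately have "list_prod \<in> iso (word_monoid (monoid_atoms G)) G"
    unfolding iso_def hom_def word_monoid_def by (simp add: Pi_iff del: foldr_append)
  then show ?thesis
    using monoid_axioms unfolding free_monoid_def is_iso_def by blast
qed

end

section \<open>The Higman ordering and concatenation\<close>

lemma higman_le_Nil: "higman_le r [] v"
  by (auto simp: higman_le_def strict_mono_on_def)

lemma higman_le_insert: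
  assumes "refl_on A r" and u: "u \<in> lists A" and v: "v \<in> lists A"
  shows "higman_le r (u @ v) (u @ w @ v)"
proof -
  \<comment> \<open>The embedding jumps over the inserted block \<open>w\<close>; reflexivity
    compares each letter with itself.\<close>
  define h where "h i = (if i < length u then i else i + length w)" for i
  have "strict_mono_on {..<length (u @ v)} h"
    by (auto simp: strict_mono_on_def h_def)
  moreover have "h i < length (u @ w @ v) \<and> ((u @ v) ! i, (u @ w @ v) ! h i) \<in> r"
    if i: "i < length (u @ v)" for i
  proof -
    have "(u @ w @ v) ! h i = (u @ v) ! i"
      by (auto simp: h_def nth_append)
    moreover have "(u @ v) ! i \<in> A"
      using nth_mem[OF i] u v by auto
    ultimately show ?thesis
      using i refl_onD[OF assms(1)] by (auto simp: h_def)
  qed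
  ultimately show ?thesis
    unfolding higman_le_def by blast
qed

text \<open>If an embedding sends all positions of \<open>y\<close> into \<open>y'\<close>,
  re-indexing both suffixes from 0 leaves an embedding of \<open>y\<close> into
  \<open>y'\<close>.\<close>

lemma higman_le_drop_prefix:
  assumes h: "strict_mono_on {..<length (x @ y)} h"
    "\<forall>i<length (x @ y). h i < length (x' @ y') \<and> ((x @ y) ! i, (x' @ y') ! h i) \<in> r"
    and ge: "\<And>i. length x \<le> i \<Longrightarrow> i < length (x @ y) \<Longrightarrow> length x' \<le> h i"
  shows "higman_le r y y'"
proof -
  \<comment> \<open>By \<open>ge\<close> the subtraction on naturals is never truncated, so
    strictness survives.\<close>
  define g where "g j = h (length x + j) - length x'" for j
  have "strict_mono_on {..<length y} g"
  proof (rule strict_mono_onI)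
    fix i j assume ij: "i \<in> {..<length y}" "j \<in> {..<length y}" "i < j"
    then have "h (length x + i) < h (length x + j)"
      using strict_mono_onD[OF h(1), of "length x + i" "length x + j"] by simp
    with ge[of "length x + i"] ij show "g i < g j"
      by (simp add: g_def)
  qed
  moreover have "g j < length y' \<and> (y ! j, y' ! g j) \<in> r" if "j < length y" for j
    using h(2)[rule_format, of "length x + j"] ge[of "length x + j"] that
    by (auto simp: g_def nth_append)
  ultimately show ?thesis
    unfolding higman_le_def by blast
qed

text \<open>Either the embedding keeps \<open>x\<close> inside \<open>x'\<close>, or some position
  of \<open>x\<close> lands in \<open>y'\<close> and monotonicity pushes all of \<open>y\<close>
  into \<open>y'\<close>.\<close>

lemma higman_le_append_split:
  assumes "higman_le r (x @ y) (x' @ y')"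
  shows "higman_le r x x' \<or> higman_le r y y'"
proof -
  obtain h where h: "strict_mono_on {..<length (x @ y)} h"
    "\<forall>i<length (x @ y). h i < length (x' @ y') \<and> ((x @ y) ! i, (x' @ y') ! h i) \<in> r"
    using assms unfolding higman_le_def by blast
  show ?thesis
  proof (cases "\<forall>i<length x. h i < length x'")
    case True
    have "strict_mono_on {..<length x} h"
      using h(1) by (auto simp: strict_mono_on_def)
    moreover have "(x ! i, x' ! h i) \<in> r" if "i < length x" for i
      using h(2)[rule_format, of i] True that by (simp add: nth_append)
    ultimately show ?thesis
      using True unfolding higman_le_def by blast
  next
    case False
    then obtain i where i: "i < length x" "length x' \<le> h i"
      by (auto simp: not_less)
    have "length x' \<le> h j" if "length x \<le> j" "j < length (x @ y)" for j
      using strict_mono_onD[OF h(1), of i j] i that by auto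
    with higman_le_drop_prefix[OF h] show ?thesis
      by blast
  qed
qed

lemma strict_mono_on_lessThan_diff:
  fixes h :: "nat \<Rightarrow> nat"
  assumes "strict_mono_on {..<n} h" and "i + k < n"
  shows "h i + k \<le> h (i + k)"
  using assms(2)
proof (induction k)
  case (Suc k)
  with strict_mono_onD[OF assms(1), of "i + k" "i + Suc k"] show ?case
    by simp
qed simp

lemma higman_le_append_left_cancel:
  assumes "higman_le r (x @ y) (x @ y')"
  shows "higman_le r y y'"
proof -
  obtain h where h: "strict_mono_on {..<length (x @ y)} h"
    "\<forall>i<length (x @ y). h i < length (x @ y') \<and> ((x @ y) ! i, (x @ y') ! h i) \<in> r"
    using assms unfolding higman_le_def by blast
  show ?thesis
  proof (rule higman_le_drop_prefix[OF h])
    fix i assume "length x \<le> i" "i < length (x @ y)"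
    \<comment> \<open>A strictly increasing map on an initial segment satisfies
      \<open>i \<le> h i\<close>.\<close>
    with strict_mono_on_lessThan_diff[OF h(1), of 0 i] show "length x \<le> h i"
      by simp
  qed
qed

text \<open>The images of the \<open>length y\<close> positions of \<open>y\<close> all lie to the
  right of \<open>h i\<close> for \<open>i\<close> in \<open>x\<close>; there is room for them only
  if \<open>h i\<close> falls inside \<open>x'\<close>.\<close>

lemma higman_le_append_right_cancel:
  assumes "higman_le r (x @ y) (x' @ y)"
  shows "higman_le r x x'"
proof -
  obtain h where h: "strict_mono_on {..<length (x @ y)} h"
    "\<forall>i<length (x @ y). h i < length (x' @ y) \<and> ((x @ y) ! i, (x' @ y) ! h i) \<in> r"
    using assms unfolding higman_le_def by blast
  have less: "h i < length x'" if i: "i < length x" for i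
  proof -
    \<comment> \<open>\<open>k\<close> letters of \<open>x\<close> follow position \<open>i\<close>,
      so \<open>i + (length y + k)\<close> is the last position of \<open>x @ y\<close>.\<close>
    define k where "k = length x - Suc i"
    have "length (x @ y) = Suc (i + (length y + k))"
      using i by (simp add: k_def)
    with strict_mono_on_lessThan_diff[OF h(1), of i "length y + k"] h(2)[rule_format, of "i + (length y + k)"]
    show ?thesis by simp
  qed
  have "strict_mono_on {..<length x} h"
    using h(1) by (auto simp: strict_mono_on_def)
  moreover have "(x ! i, x' ! h i) \<in> r" if "i < length x" for i
    using h(2)[rule_format, of i] less that by (simp add: nth_append)
  ultimately show ?thesis
    using less unfolding higman_le_def by blast
qed

lemma higman_le_append_left:
  assumes "refl_on A r" and x: "x \<in> lists A" and "higman_le r y y'"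
  shows "higman_le r (x @ y) (x @ y')"
proof -
  obtain h where h: "strict_mono_on {..<length y} h"
    "\<forall>i<length y. h i < length y' \<and> (y ! i, y' ! h i) \<in> r"
    using assms(3) unfolding higman_le_def by blast
  define g where "g i = (if i < length x then i else length x + h (i - length x))" for i
  have "strict_mono_on {..<length (x @ y)} g"
  proof (rule strict_mono_onI)
    fix i j assume "i \<in> {..<length (x @ y)}" "j \<in> {..<length (x @ y)}" "i < j"
    then show "g i < g j"
      using strict_mono_onD[OF h(1), of "i - length x" "j - length x"] by (auto simp: g_def)
  qed
  moreover have "g i < length (x @ y') \<and> ((x @ y) ! i, (x @ y') ! g i) \<in> r"
    if i: "i < length (x @ y)" for i
  proof (cases "i < length x")
    case True
    then have "x ! i \<in> A"
      using x nth_mem by blast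
    with True refl_onD[OF assms(1)] show ?thesis
      by (simp add: g_def nth_append)
  next
    case False
    with h(2)[rule_format, of "i - length x"] i show ?thesis
      by (auto simp: g_def nth_append)
  qed
  ultimately show ?thesis
    unfolding higman_le_def by blast
qed

section \<open>Antichains\<close>

lemma antichainsD:
  "X \<in> antichains A r \<Longrightarrow> v \<in> X \<Longrightarrow> w \<in> X \<Longrightarrow> higman_le r v w \<Longrightarrow> v = w"
  unfolding antichains_def by blast

lemma antichainsI:
  assumes "X \<subseteq> lists A" and "\<And>v w. v \<in> X \<Longrightarrow> w \<in> X \<Longrightarrow> higman_le r v w \<Longrightarrow> v = w"
  shows "X \<in> antichains A r"
  using assms unfolding antichains_def by blast

lemma antichains_subset_lists: "X \<in> antichains A r \<Longrightarrow> X \<subseteq> lists A"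
  by (simp add: antichains_def)

lemma lang_concatI: "x \<in> X \<Longrightarrow> y \<in> Y \<Longrightarrow> x @ y \<in> lang_concat X Y"
  unfolding lang_concat_def by blast

lemma lang_concatE:
  assumes "w \<in> lang_concat X Y"
  obtains x y where "w = x @ y" "x \<in> X" "y \<in> Y"
  using assms unfolding lang_concat_def by blast

lemma lang_concat_assoc: "lang_concat (lang_concat X Y) Z = lang_concat X (lang_concat Y Z)"
proof (intro equalityI subsetI)
  fix w assume "w \<in> lang_concat (lang_concat X Y) Z"
  then obtain x y z where "w = x @ (y @ z)" "x \<in> X" "y \<in> Y" "z \<in> Z"
    by (auto elim!: lang_concatE)
  then show "w \<in> lang_concat X (lang_concat Y Z)"
    by (blast intro: lang_concatI)
next
  fix w assume "w \<in> lang_concat X (lang_concat Y Z)"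
  then obtain x y z where "w = (x @ y) @ z" "x \<in> X" "y \<in> Y" "z \<in> Z"
    by (auto elim!: lang_concatE)
  then show "w \<in> lang_concat (lang_concat X Y) Z"
    by (blast intro: lang_concatI)
qed

lemma lang_concat_Nil: "lang_concat {[]} X = X" "lang_concat X {[]} = X"
  by (auto simp: lang_concat_def)

lemma lang_concat_empty_iff: "lang_concat X Y = {} \<longleftrightarrow> X = {} \<or> Y = {}"
  by (auto simp: lang_concat_def)

lemma antichains_Nil: "{[]} \<in> antichains A r"
  by (auto intro: antichainsI)

text \<open>Comparable products have comparable left parts or comparable right parts. Those parts
  coincide because they lie in an antichain; cancelling them makes the other parts comparable, hence
  equal.\<close>

lemma antichains_lang_concat:
  assumes X: "X \<in> antichains A r" and Y: "Y \<in> antichains A r"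
  shows "lang_concat X Y \<in> antichains A r"
proof (rule antichainsI)
  show "lang_concat X Y \<subseteq> lists A"
    using X Y by (force simp: antichains_def lang_concat_def)
next
  fix v w
  assume "v \<in> lang_concat X Y" "w \<in> lang_concat X Y" and le: "higman_le r v w"
  then obtain x y x' y' where [simp]: "v = x @ y" "w = x' @ y'"
    and xy: "x \<in> X" "y \<in> Y" "x' \<in> X" "y' \<in> Y"
    unfolding lang_concat_def by blast
  have "higman_le r x x' \<or> higman_le r y y'"
    using le higman_le_append_split[of r x y x' y'] by simp
  then show "v = w"
  proof
    assume "higman_le r x x'"
    then have "x = x'"
      using antichainsD[OF X] xy by blast
    with le have "higman_le r y y'"
      by (auto intro: higman_le_append_left_cancel)
    with \<open>x = x'\<close> show ?thesis
      using antichainsD[OF Y] xy by simp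
  next
    assume "higman_le r y y'"
    then have "y = y'"
      using antichainsD[OF Y] xy by blast
    with le have "higman_le r x x'"
      by (auto intro: higman_le_append_right_cancel)
    with \<open>y = y'\<close> show ?thesis
      using antichainsD[OF X] xy by simp
  qed
qed

section \<open>Prefix codes and right factors\<close>

text \<open>Deleting a block of letters yields a smaller word, so an antichain cannot contain both
  words unless the block is empty. The later arguments on cuts rest on this.\<close>

lemma antichains_insert_eq:
  assumes "refl_on A r" and X: "X \<in> antichains A r"
    and "u @ v \<in> X" and uwv: "u @ w @ v \<in> X"
  shows "w = []"
proof -
  have "u \<in> lists A" "v \<in> lists A"
    using antichains_subset_lists[OF X] uwv by auto
  then have "higman_le r (u @ v) (u @ w @ v)"
    by (rule higman_le_insert[OF assms(1)])
  then have "u @ v = u @ w @ v"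
    using antichainsD[OF X] assms(3) uwv by blast
  then show ?thesis by simp
qed

text \<open>An antichain is a prefix code: of two prefixes of one word, the shorter arises from the
  longer by deleting its end.\<close>

lemma antichains_prefix_eq:
  assumes "refl_on A r" and "X \<in> antichains A r"
    and "x \<in> X" "x' \<in> X" and "x @ y = x' @ y'"
  shows "x = x' \<and> y = y'"
proof -
  obtain v where "x = x' @ v \<and> v @ y = y' \<or> x @ v = x' \<and> y = v @ y'"
    using assms(5) by (auto simp: append_eq_append_conv2)
  moreover from this have "v = []"
    using antichains_insert_eq[OF assms(1,2), of _ "[]" v] assms(3,4) by auto
  ultimately show ?thesis
    by simp
qed

lemma antichains_Nil_mem:
  assumes "X \<in> antichains A r" and "[] \<in> X"
  shows "X = {[]}"
  using antichainsD[OF assms(1,2)] assms(2) higman_le_Nil by blast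

text \<open>Prepending a fixed \<open>x \<in> X\<close> preserves the ordering, so comparable words
  of \<open>U\<close> would give comparable words of \<open>lang_concat X U\<close>.\<close>

lemma antichains_right_factor:
  assumes "refl_on A r" and X: "X \<in> antichains A r" "X \<noteq> {}"
    and XU: "lang_concat X U \<in> antichains A r"
  shows "U \<in> antichains A r"
proof -
  obtain x where x: "x \<in> X"
    using X(2) by blast
  show ?thesis
  proof (rule antichainsI)
    show "U \<subseteq> lists A"
      using antichains_subset_lists[OF XU] lang_concatI[OF x] by fastforce
  next
    fix v w assume vw: "v \<in> U" "w \<in> U" "higman_le r v w"
    have "x \<in> lists A"
      using antichains_subset_lists[OF X(1)] x by blast
    then have "higman_le r (x @ v) (x @ w)"
      using higman_le_append_left[OF assms(1)] vw by blast
    then have "x @ v = x @ w"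
      using antichainsD[OF XU] lang_concatI[OF x] vw by blast
    then show "v = w" by simp
  qed
qed

lemma finite_right_factor:
  assumes "X \<noteq> {}" and "finite (lang_concat X U)"
  shows "finite U"
proof -
  obtain x where "x \<in> X"
    using assms(1) by blast
  then have "(@) x ` U \<subseteq> lang_concat X U"
    by (auto intro: lang_concatI)
  then have "finite ((@) x ` U)"
    using assms(2) by (rule finite_subset)
  then show ?thesis
    by (rule finite_imageD) (simp add: inj_on_def)
qed

section \<open>Equidivisibility of antichains\<close>

text \<open>The words \<open>x @ u @ t\<close> and \<open>z @ v @ y\<close> have their two cuts in
  opposite orders. Recombining pieces gives \<open>z @ v @ u @ t\<close> through \<open>X\<close>
  and \<open>Y\<close>, and \<open>z @ t\<close> through \<open>Z\<close> and \<open>T\<close>; they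
  differ by the block \<open>v @ u\<close>.\<close>

lemma antichains_cuts_comparable:
  assumes "refl_on A r" and XY: "lang_concat X Y \<in> antichains A r"
    and eq: "lang_concat X Y = lang_concat Z T"
    and 1: "x \<in> X" "x @ u \<in> Z" "u @ t \<in> Y" "t \<in> T"
    and 2: "z \<in> Z" "z @ v \<in> X" "v @ y \<in> T" "y \<in> Y"
  shows "u = [] \<and> v = []"
proof -
  have "(z @ v) @ (u @ t) \<in> lang_concat X Y" "z @ t \<in> lang_concat X Y"
    using lang_concatI[OF 2(2) 1(3)] lang_concatI[OF 2(1) 1(4)] eq by auto
  then have "v @ u = []"
    using antichains_insert_eq[OF assms(1) XY, of z t "v @ u"] by simp
  then show ?thesis by simp
qed

text \<open>When the cut between \<open>X\<close> and \<open>Y\<close> never comes after the cut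
  between \<open>Z\<close> and \<open>T\<close>, the pieces between the cuts form the common middle
  factor.\<close>

lemma antichains_middle_factor:
  assumes "refl_on A r"
    and X: "X \<in> antichains A r" and Y: "Y \<in> antichains A r"
    and ne: "X \<noteq> {}" "T \<noteq> {}"
    and eq: "lang_concat X Y = lang_concat Z T"
    and cut: "\<And>x y z t. x \<in> X \<Longrightarrow> y \<in> Y \<Longrightarrow> z \<in> Z \<Longrightarrow> t \<in> T \<Longrightarrow> x @ y = z @ t \<Longrightarrow>
                \<exists>u. z = x @ u \<and> y = u @ t"
  shows "\<exists>U. Z = lang_concat X U \<and> Y = lang_concat U T"
proof -
  \<comment> \<open>A middle piece needs only some \<open>x\<close> and some \<open>t\<close> as
    context; the inclusions below show that every context works.\<close>
  define U where "U = {u. \<exists>x\<in>X. \<exists>t\<in>T. x @ u \<in> Z \<and> u @ t \<in> Y}"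
  have XY: "lang_concat X Y \<in> antichains A r"
    using X Y by (rule antichains_lang_concat)
  have ins: "w = []" if "u @ v \<in> lang_concat X Y" "u @ w @ v \<in> lang_concat X Y" for u v w
    using antichains_insert_eq[OF assms(1) XY that] .
  have "lang_concat X U \<subseteq> Z"
  proof
    fix w assume "w \<in> lang_concat X U"
    then obtain x u x' t where w: "w = x @ u" "x \<in> X"
      and u: "x' \<in> X" "t \<in> T" "x' @ u \<in> Z" "u @ t \<in> Y"
      unfolding U_def lang_concat_def by blast
    \<comment> \<open>The context \<open>x\<close> may differ from the witness \<open>x'\<close>, so
      the word is cut afresh, with middle piece \<open>u'\<close>. Then \<open>u\<close> and
      \<open>u'\<close> differ by a suffix \<open>v\<close>, and exchanging \<open>t\<close> and
      \<open>t'\<close> produces two words of the antichain that differ by the insertion of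
      \<open>v\<close>.\<close>
    have "x @ u @ t \<in> lang_concat Z T"
      using lang_concatI[OF w(2) u(4)] eq by simp
    then obtain z t' where z: "x @ u @ t = z @ t'" "z \<in> Z" "t' \<in> T"
      by (rule lang_concatE)
    then obtain u' where u': "z = x @ u'" "u @ t = u' @ t'"
      using cut[OF w(2) u(4)] by blast
    then obtain v where "u = u' @ v \<and> v @ t = t' \<or> u @ v = u' \<and> t = v @ t'"
      by (auto simp: append_eq_append_conv2)
    then show "w \<in> Z"
    proof
      assume v: "u = u' @ v \<and> v @ t = t'"
      have "(x @ u') @ t \<in> lang_concat X Y"
        using lang_concatI[OF z(2) u(2)] u' eq by simp
      moreover have "(x @ u') @ v @ t \<in> lang_concat X Y"
        using lang_concatI[OF w(2) u(4)] v by simp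
      ultimately have "v = []"
        by (rule ins)
      with v w u' z show ?thesis by simp
    next
      assume v: "u @ v = u' \<and> t = v @ t'"
      have "(x @ u @ v) @ t' \<in> lang_concat X Y"
        using lang_concatI[OF z(2,3)] u' v eq by simp
      moreover have "(x @ u @ v) @ v @ t' \<in> lang_concat X Y"
        using lang_concatI[OF z(2) u(2)] u' v eq by simp
      ultimately have "v = []"
        by (rule ins)
      with v w u' z show ?thesis by simp
    qed
  qed
  moreover have "Z \<subseteq> lang_concat X U"
  proof
    fix z assume z: "z \<in> Z"
    obtain t where t: "t \<in> T"
      using ne by blast
    have "z @ t \<in> lang_concat X Y"
      using lang_concatI[OF z t] eq by simp
    then obtain x y where xy: "z @ t = x @ y" "x \<in> X" "y \<in> Y"
      by (rule lang_concatE)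
    then obtain u where "z = x @ u" "y = u @ t"
      using cut[OF xy(2,3) z t] by auto
    with xy z t show "z \<in> lang_concat X U"
      unfolding U_def by (auto intro: lang_concatI)
  qed
  moreover have "lang_concat U T \<subseteq> Y"
  proof
    fix w assume "w \<in> lang_concat U T"
    then obtain u t x where w: "w = u @ t" "t \<in> T" and x: "x \<in> X" "x @ u \<in> Z"
      unfolding U_def lang_concat_def by blast
    have "x @ w \<in> lang_concat X Y"
      using lang_concatI[OF x(2) w(2)] w eq by simp
    then obtain x' y where x'y: "x @ w = x' @ y" "x' \<in> X" "y \<in> Y"
      by (rule lang_concatE)
    \<comment> \<open>The prefix code \<open>X\<close> determines where this word is cut.\<close>
    then have "w = y"
      using antichains_prefix_eq[OF assms(1) X x(1) x'y(2,1)] by simp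
    with x'y show "w \<in> Y" by simp
  qed
  moreover have "Y \<subseteq> lang_concat U T"
  proof
    fix y assume y: "y \<in> Y"
    obtain x where x: "x \<in> X"
      using ne by blast
    have "x @ y \<in> lang_concat Z T"
      using lang_concatI[OF x y] eq by simp
    then obtain z t where zt: "x @ y = z @ t" "z \<in> Z" "t \<in> T"
      by (rule lang_concatE)
    then obtain u where "z = x @ u" "y = u @ t"
      using cut[OF x y] by blast
    with zt x y show "y \<in> lang_concat U T"
      unfolding U_def by (auto intro: lang_concatI)
  qed
  ultimately show ?thesis by blast
qed

lemma antichains_equidivisible:
  assumes "refl_on A r"
    and X: "X \<in> antichains A r" "X \<noteq> {}" and Y: "Y \<in> antichains A r" "Y \<noteq> {}"
    and Z: "Z \<in> antichains A r" "Z \<noteq> {}" and T: "T \<in> antichains A r" "T \<noteq> {}"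
    and eq: "lang_concat X Y = lang_concat Z T"
  shows "\<exists>U. Z = lang_concat X U \<and> Y = lang_concat U T \<or> X = lang_concat Z U \<and> T = lang_concat U Y"
proof (cases "\<forall>x\<in>X. \<forall>y\<in>Y. \<forall>z\<in>Z. \<forall>t\<in>T. x @ y = z @ t \<longrightarrow> (\<exists>u. z = x @ u \<and> y = u @ t)")
  case True
  then show ?thesis
    using antichains_middle_factor[OF assms(1) X(1) Y(1) X(2) T(2) eq] by blast
next
  case False
  then obtain x\<^sub>0 y\<^sub>0 z\<^sub>0 t\<^sub>0 where 0: "x\<^sub>0 \<in> X" "y\<^sub>0 \<in> Y" "z\<^sub>0 \<in> Z" "t\<^sub>0 \<in> T" "x\<^sub>0 @ y\<^sub>0 = z\<^sub>0 @ t\<^sub>0"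
    and no: "\<nexists>u. z\<^sub>0 = x\<^sub>0 @ u \<and> y\<^sub>0 = u @ t\<^sub>0"
    by blast
  \<comment> \<open>The failing word has its \<open>X\<close>-\<open>Y\<close> cut strictly after
    its \<open>Z\<close>-\<open>T\<close> cut; \<open>v\<close> is the nonempty gap.\<close>
  then obtain v where v: "x\<^sub>0 = z\<^sub>0 @ v" "t\<^sub>0 = v @ y\<^sub>0" "v \<noteq> []"
    by (auto simp: append_eq_append_conv2)
  have XY: "lang_concat X Y \<in> antichains A r"
    using X(1) Y(1) by (rule antichains_lang_concat)
  have "\<exists>u. x = z @ u \<and> t = u @ y"
    if mem: "x \<in> X" "y \<in> Y" "z \<in> Z" "t \<in> T" and "z @ t = x @ y" for x y z t
  proof -
    obtain u where "z @ u = x \<and> t = u @ y \<or> z = x @ u \<and> u @ t = y"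
      using \<open>z @ t = x @ y\<close> by (auto simp: append_eq_append_conv2)
    \<comment> \<open>A nonempty gap in the other direction is refuted by comparison with the word
      \<open>x\<^sub>0 @ y\<^sub>0\<close>, so every word satisfies the cut condition with the two
      factorisations exchanged.\<close>
    moreover have False if "z = x @ u" "u @ t = y" "u \<noteq> []"
      using antichains_cuts_comparable[OF assms(1) XY eq, of x u t z\<^sub>0 v y\<^sub>0] 0 v mem that by auto
    ultimately show ?thesis
      by (cases "u = []") auto
  qed
  then show ?thesis
    using antichains_middle_factor[OF assms(1) Z(1) T(1) Z(2) Y(2) eq[symmetric]] by blast
qed

section \<open>The length function\<close>

definition min_length :: "'a list set \<Rightarrow> nat" where
  "min_length X = Inf (length ` X)"

text \<open>Joining shortest words gives the upper bound; the lower bound holds for each product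
  word separately.\<close>

lemma min_length_concat:
  assumes "X \<noteq> {}" "Y \<noteq> {}"
  shows "min_length (lang_concat X Y) = min_length X + min_length Y"
proof (rule antisym)
  obtain x y where "x \<in> X" "min_length X = length x" "y \<in> Y" "min_length Y = length y"
    using assms Inf_nat_def1[of "length ` X"] Inf_nat_def1[of "length ` Y"]
    unfolding min_length_def by fastforce
  then show "min_length (lang_concat X Y) \<le> min_length X + min_length Y"
    unfolding min_length_def by (auto intro!: cInf_lower intro: rev_image_eqI lang_concatI)
next
  show "min_length X + min_length Y \<le> min_length (lang_concat X Y)"
    using assms unfolding min_length_def
    by (intro cInf_greatest)
       (auto simp: lang_concat_empty_iff elim!: lang_concatE intro!: add_mono cInf_lower)
qed

text \<open>The minimum is attained, so the empty word belongs to \<open>X\<close>; it lies below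
  every word and hence is the only one.\<close>

lemma min_length_eq_0:
  assumes "X \<in> antichains A r" "X \<noteq> {}" "min_length X = 0"
  shows "X = {[]}"
proof -
  have "0 \<in> length ` X"
    using assms(2,3) Inf_nat_def1[of "length ` X"] unfolding min_length_def by simp
  then show ?thesis
    using antichains_Nil_mem[OF assms(1)] by auto
qed

section \<open>Freeness of both monoids\<close>

text \<open>A common treatment of all antichains and of the finite ones: closure under right factors
  keeps the middle factor of equidivisibility inside \<open>C\<close>.\<close>

lemma free_monoid_of_antichains:
  assumes "refl_on A r" and C: "C \<subseteq> antichains A r - {{}}" and one: "{[]} \<in> C"
    and closed: "\<And>X Y. X \<in> C \<Longrightarrow> Y \<in> C \<Longrightarrow> lang_concat X Y \<in> C"
    and right_factor: "\<And>X U. X \<in> C \<Longrightarrow> U \<in> antichains A r \<Longrightarrow> lang_concat X U \<in> C \<Longrightarrow> U \<in> C"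
  shows "free_monoid \<lparr>carrier = C, mult = lang_concat, one = {[]}\<rparr>"
    (is "free_monoid ?M")
proof -
  interpret Group.monoid ?M
    by standard (auto simp: one closed lang_concat_assoc lang_concat_Nil)
  have factor: "U \<in> C" if "X \<in> C" "lang_concat X U \<in> C" for X U
    using right_factor[OF that(1) _ that(2)] antichains_right_factor[OF assms(1)] C that by blast
  have "equidivisible ?M"
    unfolding equidivisible_def
  proof (simp, intro ballI impI)
    fix X Y Z T assume XYZT: "X \<in> C" "Y \<in> C" "Z \<in> C" "T \<in> C" "lang_concat X Y = lang_concat Z T"
    then obtain U where "Z = lang_concat X U \<and> Y = lang_concat U T \<or> X = lang_concat Z U \<and> T = lang_concat U Y"
      using antichains_equidivisible[OF assms(1), of X Y Z T] C by blast
    \<comment> \<open>In either case \<open>U\<close> is a right factor of an element of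
      \<open>C\<close>: of \<open>Z\<close> or of \<open>X\<close>.\<close>
    moreover from this have "U \<in> C"
      using factor XYZT by blast
    ultimately show "\<exists>U\<in>C. Z = lang_concat X U \<and> Y = lang_concat U T \<or> X = lang_concat Z U \<and> T = lang_concat U Y"
      by blast
  qed
  moreover have "min_length (lang_concat X Y) = min_length X + min_length Y" if "X \<in> C" "Y \<in> C" for X Y
    by (rule min_length_concat) (use that C in blast)+
  moreover have "X = {[]}" if "X \<in> C" "min_length X = 0" for X
    by (rule min_length_eq_0[of _ A r]) (use that C in blast)+
  ultimately show ?thesis
    by (intro free_monoid_if_equidivisible[of min_length]) simp_all
qed

theorem theorem2:
  fixes A :: "'a set" and r :: "'a rel"
  assumes "partial_order_on A r"
  shows "free_monoid (antichain_monoid A r) \<and> free_monoid (fin_antichain_monoid A r)"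
proof -
  have refl: "refl_on A r"
    using assms by (simp add: partial_order_on_def preorder_on_def)
  have finite_concat: "finite (lang_concat X Y)" if "finite X" "finite Y" for X Y :: "'a list set"
    using that finite_image_set2[of "\<lambda>x. x \<in> X" "\<lambda>y. y \<in> Y" "(@)"] by (simp add: lang_concat_def)
  have "free_monoid (antichain_monoid A r)"
    unfolding antichain_monoid_def
    by (rule free_monoid_of_antichains[OF refl])
       (auto simp: antichains_Nil antichains_lang_concat lang_concat_empty_iff)
  moreover have "free_monoid (fin_antichain_monoid A r)"
    unfolding fin_antichain_monoid_def
    by (rule free_monoid_of_antichains[OF refl])
       \<comment> \<open>A right factor of a finite product is finite because prepending a fixed
         word is injective; it is nonempty because the product is.\<close>
       (use finite_right_factor in \<open>auto simp: antichains_Nil antichains_lang_concat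
          lang_concat_empty_iff finite_concat\<close>)
  ultimately show ?thesis ..
qed

end
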